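(* Let $\alpha\in(0,1)$, $\tau\in(0,1)$, $\beta^*\in\mathbb R^d$ with $\|\beta^*\|_2\le1$, and let the underlying distribution be $P_{\beta^*,E}$ for an unknown univariate $E$ with $\mathbb P_{Z\sim E}(Z=0)\ge\alpha$, where $\alpha$ is known. There exists an SQ algorithm that uses $q\le\exp(O(d\log(1/(\tau\alpha))))$ queries to $\mathrm{VSTAT}(m)$ for some $m\lesssim1/\alpha$ and outputs an estimate $\widehat\beta$ with $\|\widehat\beta-\beta^*\|_2\lesssim\tau$. Furthermore, with high probability, the $\mathrm{VSTAT}(m)$ oracle for this algorithm can be simulated using $m'=\widetilde O(d/\alpha)$ i.i.d. samples from $P_{\beta^*,E}$.
   Context: $P_{\beta,E}$: distribution of $(x,y)$ with $x\sim\mathcal N(0,I_d)$, $y=x^\top\beta+Z$, $Z\sim E$ independent of $x$. $\mathrm{VSTAT}(m)$ oracle for a distribution $D$: given $f:\mathbb R^d\times\mathbb R\to[0,1]$, returns any $u$ with $|u-\mathbb E_D[f]|\le\max\{1/m,\sqrt{\mathbb E_D[f](1-\mathbb E_D[f])/m}\}$; an SQ algorithm accesses the distribution only through such queries and must succeed for every valid oracle. $\lesssim$, $O$ hide absolute constants; $\widetilde O$ also hides polylogarithmic factors. *)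

theory Defs
  imports "HOL-Probability.Probability"
begin

text \<open>
  Vectors of \<open>\<real>\<^sup>d\<close> are functions \<^typ>\<open>nat \<Rightarrow> real\<close> of which only the coordinates \<open>i < d\<close>
  matter.  The dimension is a term and not a type so that the absolute constants in a statement
  can be chosen before \<open>d\<close>.
\<close>

type_synonym point = "(nat \<Rightarrow> real) \<times> real"

definition data_space :: "nat \<Rightarrow> point measure" where
  "data_space d = (\<Pi>\<^sub>M i\<in>{..<d}. (borel :: real measure)) \<Otimes>\<^sub>M borel"

definition std_gaussian :: "nat \<Rightarrow> (nat \<Rightarrow> real) measure" where
  "std_gaussian d = (\<Pi>\<^sub>M i\<in>{..<d}. density lborel std_normal_density)"

text \<open>The law of \<open>(x, x\<^sup>T \<beta> + Z)\<close>; the product measure makes \<open>Z\<close> independent of \<open>x\<close>.\<close>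

definition regression_dist :: "nat \<Rightarrow> (nat \<Rightarrow> real) \<Rightarrow> real measure \<Rightarrow> point measure" where
  "regression_dist d \<beta> E =
     distr (std_gaussian d \<Otimes>\<^sub>M E) (data_space d) (\<lambda>(x, z). (x, (\<Sum>i<d. x i * \<beta> i) + z))"

definition oblivious_noise :: "real \<Rightarrow> real measure \<Rightarrow> bool" where
  "oblivious_noise \<alpha> E \<longleftrightarrow> prob_space E \<and> sets E = sets borel \<and> measure E {0} \<ge> \<alpha>"

text \<open>The answers that a VSTAT(m) oracle for \<open>D\<close> may give to the query \<open>f\<close>; meant for \<open>m > 0\<close>.\<close>

definition vstat :: "nat \<Rightarrow> 'x measure \<Rightarrow> ('x \<Rightarrow> real) \<Rightarrow> real set" where
  "vstat m D f =
     (let p = (\<integral>z. f z \<partial>D) in {u. \<bar>u - p\<bar> \<le> max (1 / real m) (sqrt (p * (1 - p) / real m))})"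

text \<open>
  A statistical query algorithm as an adaptive decision tree: it either stops with an output, or
  asks a query and continues depending on the real number it receives as answer.
\<close>

datatype ('x, 'o) sq_alg = Output 'o | Query "'x \<Rightarrow> real" "real \<Rightarrow> ('x, 'o) sq_alg"

primrec valid_queries :: "'x measure \<Rightarrow> ('x, 'o) sq_alg \<Rightarrow> bool" where
  "valid_queries S (Output b) \<longleftrightarrow> True"
| "valid_queries S (Query f k) \<longleftrightarrow>
     f \<in> borel_measurable S \<and> (\<forall>z\<in>space S. f z \<in> {0..1}) \<and> (\<forall>u. valid_queries S (k u))"

primrec at_most_queries :: "('x, 'o) sq_alg \<Rightarrow> nat \<Rightarrow> bool" where
  "at_most_queries (Output b) = (\<lambda>q. True)"
| "at_most_queries (Query f k) = (\<lambda>q. q > 0 \<and> (\<forall>u. at_most_queries (k u) (q - 1)))"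

text \<open>
  All outputs that can arise when every query is answered by some valid VSTAT(m) answer.  The
  oracle may be adversarial and may depend on the history.
\<close>

primrec vstat_outputs :: "nat \<Rightarrow> 'x measure \<Rightarrow> ('x, 'o) sq_alg \<Rightarrow> 'o set" where
  "vstat_outputs m D (Output b) = {b}"
| "vstat_outputs m D (Query f k) = (\<Union>u\<in>vstat m D f. vstat_outputs m D (k u))"

text \<open>
  In the run of the algorithm in which each query \<open>f\<close> is answered by \<open>orc f\<close>, all answers are
  valid VSTAT(m) answers for \<open>D\<close>.
\<close>

primrec vstat_run :: "nat \<Rightarrow> 'x measure \<Rightarrow> (('x \<Rightarrow> real) \<Rightarrow> real) \<Rightarrow> ('x, 'o) sq_alg \<Rightarrow> bool" where
  "vstat_run m D orc (Output b) \<longleftrightarrow> True"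
| "vstat_run m D orc (Query f k) \<longleftrightarrow> orc f \<in> vstat m D f \<and> vstat_run m D orc (k (orc f))"

definition iid_samples :: "nat \<Rightarrow> 'x measure \<Rightarrow> (nat \<Rightarrow> 'x) measure" where
  "iid_samples n D = (\<Pi>\<^sub>M i\<in>{..<n}. D)"

text \<open>
  The map \<open>sim\<close>, which sees only \<open>n\<close> samples and the query, simulates the VSTAT(m) oracle for the
  algorithm with probability at least \<open>1 - \<delta>\<close>.  Since \<^const>\<open>measure\<close> is 0 on non-measurable sets,
  for \<open>\<delta> < 1\<close> this includes measurability of the event.
\<close>

definition simulates_vstat ::
  "nat \<Rightarrow> 'x measure \<Rightarrow> ('x, 'o) sq_alg \<Rightarrow> nat \<Rightarrow> ((nat \<Rightarrow> 'x) \<Rightarrow> ('x \<Rightarrow> real) \<Rightarrow> real) \<Rightarrow> real \<Rightarrow> bool"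
where
  "simulates_vstat m D A n sim \<delta> \<longleftrightarrow>
     measure (iid_samples n D) {s \<in> space (iid_samples n D). vstat_run m D (sim s) A} \<ge> 1 - \<delta>"

end

theory Submission
  imports Defs
begin

text \<open>
  The algorithm runs through an \<open>\<epsilon>\<close>-net of the unit ball, \<open>\<epsilon> = \<tau> \<alpha> / 40\<close>, and for each candidate \<open>b\<close>
  asks for the probability of \<open>\<bar>y - x\<^sup>T b\<bar> \<le> 4 \<epsilon>\<close>.  The residual is \<open>x\<^sup>T (\<beta> - b) + Z\<close> with
  \<open>x\<^sup>T (\<beta> - b)\<close> centred Gaussian of standard deviation \<open>\<parallel>\<beta> - b\<parallel>\<close>.  If \<open>\<parallel>\<beta> - b\<parallel> \<le> \<epsilon>\<close>, Chebyshev's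
  inequality on the event \<open>Z = 0\<close> makes the probability at least \<open>15 \<alpha> / 16\<close>; if \<open>\<parallel>\<beta> - b\<parallel> > \<tau>\<close>,
  boundedness of the Gaussian density makes it at most \<open>\<alpha> / 10\<close>, whatever the law of \<open>Z\<close>.
  VSTAT(\<open>\<lceil>100 / \<alpha>\<rceil>\<close>) separates the two cases.  As the queries come from a fixed family whose
  size is the size of the net, Bernstein's inequality and a union bound show that empirical
  means simulate the oracle.
\<close>

subsection \<open>A net of the Euclidean unit ball\<close>

text \<open>A telescoping bound: since \<open>\<epsilon> \<le> exp \<epsilon> - 1\<close>, the two
  new terms in each induction step are at most the increment of the right-hand side. Bounding
  partial sums this way avoids infinite series.\<close>

lemma sum_exp_abs_le:
  fixes \<epsilon> :: real
  assumes "\<epsilon> > 0"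
  shows "(\<Sum>k\<in>{- int n..int n}. exp (- \<epsilon> * real_of_int \<bar>k\<bar>)) \<le> 1 + 2 / \<epsilon> * (1 - exp (- \<epsilon> * real n))"
proof (induction n)
  case (Suc n)
  have eq: "{- int (Suc n)..int (Suc n)} = insert (int (Suc n)) (insert (- int (Suc n)) {- int n..int n})"
    by auto
  have "\<epsilon> * exp (- \<epsilon> * real (Suc n)) \<le> (exp \<epsilon> - 1) * exp (- \<epsilon> * real (Suc n))"
    by (intro mult_right_mono) (use exp_ge_add_one_self[of \<epsilon>] in linarith, simp)
  also have "\<dots> = exp (- \<epsilon> * real n) - exp (- \<epsilon> * real (Suc n))"
    by (simp add: algebra_simps flip: exp_add)
  finally have step: "2 * exp (- \<epsilon> * real (Suc n)) \<le> 2 / \<epsilon> * (exp (- \<epsilon> * real n) - exp (- \<epsilon> * real (Suc n)))"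
    using assms by (simp add: field_simps)
  have "(\<Sum>k\<in>{- int (Suc n)..int (Suc n)}. exp (- \<epsilon> * real_of_int \<bar>k\<bar>))
      = 2 * exp (- \<epsilon> * real (Suc n)) + (\<Sum>k\<in>{- int n..int n}. exp (- \<epsilon> * real_of_int \<bar>k\<bar>))"
    unfolding eq by (subst sum.insert; simp)+
  also have "\<dots> \<le> 2 / \<epsilon> * (exp (- \<epsilon> * real n) - exp (- \<epsilon> * real (Suc n))) + (1 + 2 / \<epsilon> * (1 - exp (- \<epsilon> * real n)))"
    using step Suc.IH by linarith
  also have "\<dots> = 1 + 2 / \<epsilon> * (1 - exp (- \<epsilon> * real (Suc n)))"
    by (simp add: algebra_simps)
  finally show ?case .
qed simp

text \<open>The \<open>l1\<close> norm is used because its exponential weight factorises over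
  coordinates. Extensional functions keep the set finite.\<close>

definition int_l1_ball :: "nat \<Rightarrow> real \<Rightarrow> (nat \<Rightarrow> int) set" where
  "int_l1_ball d R = {k \<in> {..<d} \<rightarrow>\<^sub>E UNIV. (\<Sum>i<d. real_of_int \<bar>k i\<bar>) \<le> R}"

lemma int_l1_ball_subset:
  "int_l1_ball d R \<subseteq> {..<d} \<rightarrow>\<^sub>E {- int (nat \<lfloor>R\<rfloor>)..int (nat \<lfloor>R\<rfloor>)}"
proof
  fix k assume k: "k \<in> int_l1_ball d R"
  have "k i \<in> {- int (nat \<lfloor>R\<rfloor>)..int (nat \<lfloor>R\<rfloor>)}" if "i < d" for i
  proof -
    have "real_of_int \<bar>k i\<bar> \<le> (\<Sum>i<d. real_of_int \<bar>k i\<bar>)"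
      using that by (intro member_le_sum) auto
    also have "\<dots> \<le> R" using k by (simp add: int_l1_ball_def)
    finally have "\<bar>k i\<bar> \<le> \<lfloor>R\<rfloor>" by (simp only: le_floor_iff)
    then show ?thesis by simp linarith
  qed
  with k show "k \<in> {..<d} \<rightarrow>\<^sub>E {- int (nat \<lfloor>R\<rfloor>)..int (nat \<lfloor>R\<rfloor>)}"
    by (auto simp: int_l1_ball_def PiE_iff)
qed

lemma finite_int_l1_ball: "finite (int_l1_ball d R)"
  by (rule finite_subset[OF int_l1_ball_subset]) (intro finite_PiE, auto)

text \<open>
  Chernoff-type counting: every point of the ball has weight at least \<open>exp (- d)\<close> under
  \<open>exp (- \<epsilon> \<parallel>k\<parallel>\<^sub>1)\<close>, whose total mass over the lattice factorises.
\<close>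

lemma card_int_l1_ball_le:
  fixes \<epsilon> :: real
  assumes "\<epsilon> > 0"
  shows "real (card (int_l1_ball d (real d / \<epsilon>))) \<le> (exp 1 * (1 + 2 / \<epsilon>)) ^ d"
proof -
  let ?B = "int_l1_ball d (real d / \<epsilon>)" and ?N = "nat \<lfloor>real d / \<epsilon>\<rfloor>"
  let ?w = "\<lambda>k. \<Prod>i<d. exp (- \<epsilon> * real_of_int \<bar>k i :: int\<bar>)"
  have w: "?w k = exp (- \<epsilon> * (\<Sum>i<d. real_of_int \<bar>k i\<bar>))" for k
    by (simp add: exp_sum sum_distrib_left)
  have "real (card ?B) * exp (- real d) = (\<Sum>k\<in>?B. exp (- real d))" by simp
  also have "\<dots> \<le> (\<Sum>k\<in>?B. ?w k)"
    using assms unfolding w by (intro sum_mono) (auto simp: int_l1_ball_def field_simps)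
  also have "\<dots> \<le> (\<Sum>k\<in>{..<d} \<rightarrow>\<^sub>E {- int ?N..int ?N}. ?w k)"
    by (intro sum_mono2 finite_PiE int_l1_ball_subset prod_nonneg) auto
  also have "\<dots> = (\<Prod>i<d. \<Sum>k\<in>{- int ?N..int ?N}. exp (- \<epsilon> * real_of_int \<bar>k\<bar>))"
    by (subst prod_sum_PiE) auto
  also have "\<dots> \<le> (\<Prod>i<d. 1 + 2 / \<epsilon>)"
  proof (intro prod_mono conjI sum_nonneg)
    have "2 / \<epsilon> * (1 - exp (- \<epsilon> * real ?N)) \<le> 2 / \<epsilon> * 1"
      using assms by (intro mult_left_mono) auto
    with sum_exp_abs_le[OF assms, of ?N]
    show "(\<Sum>k\<in>{- int ?N..int ?N}. exp (- \<epsilon> * real_of_int \<bar>k\<bar>)) \<le> 1 + 2 / \<epsilon>" by linarith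
  qed auto
  finally have "real (card ?B) * exp (- real d) \<le> (1 + 2 / \<epsilon>) ^ d" by simp
  then have "real (card ?B) \<le> exp (real d) * (1 + 2 / \<epsilon>) ^ d"
    by (simp add: exp_minus field_simps)
  also have "exp (real d) = exp 1 ^ d" by (simp flip: exp_of_nat_mult)
  finally show ?thesis by (simp add: power_mult_distrib)
qed

text \<open>With mesh \<open>\<epsilon> / sqrt d\<close>, an error of one mesh width per coordinate
  has Euclidean norm \<open>\<epsilon>\<close>. The radius \<open>d / \<epsilon>\<close> is
  \<open>sqrt d\<close>, the largest \<open>l1\<close> norm on the unit ball, in units of the mesh.
  A cube of the same mesh would cost an extra factor of order \<open>d ^ (d / 2)\<close>, too much
  for the query bound.\<close>

definition grid_net :: "nat \<Rightarrow> real \<Rightarrow> (nat \<Rightarrow> real) set" where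
  "grid_net d \<epsilon> = (\<lambda>k i. real_of_int (k i) * (\<epsilon> / sqrt (real d))) ` int_l1_ball d (real d / \<epsilon>)"

lemma finite_grid_net: "finite (grid_net d \<epsilon>)"
  by (simp add: grid_net_def finite_int_l1_ball)

lemma card_grid_net_le:
  assumes "\<epsilon> > 0"
  shows "real (card (grid_net d \<epsilon>)) \<le> (exp 1 * (1 + 2 / \<epsilon>)) ^ d"
proof -
  have "card (grid_net d \<epsilon>) \<le> card (int_l1_ball d (real d / \<epsilon>))"
    unfolding grid_net_def by (intro card_image_le finite_int_l1_ball)
  with card_int_l1_ball_le[OF assms, of d] show ?thesis by linarith
qed

lemma sum_abs_le_sqrt_mult_L2_set:
  "(\<Sum>i<d. \<bar>\<beta> i\<bar>) \<le> sqrt (real d) * L2_set \<beta> {..<d}"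
  using L2_set_mult_ineq[of "\<lambda>_. 1" \<beta> "{..<d}"] by (simp add: L2_set_def)

text \<open>Each coordinate is rounded to the mesh \<open>h\<close>. By Cauchy-Schwarz the unit ball
  has \<open>l1\<close> radius at most \<open>sqrt d\<close>, so the rounded point belongs to the
  net, and the error is at most \<open>sqrt d * h = \<epsilon>\<close>.\<close>

lemma grid_net_covers:
  assumes "\<epsilon> > 0" and d: "1 \<le> d" and \<beta>: "L2_set \<beta> {..<d} \<le> 1"
  shows "\<exists>b\<in>grid_net d \<epsilon>. L2_set (\<lambda>i. \<beta> i - b i) {..<d} \<le> \<epsilon>"
proof -
  define h where "h = \<epsilon> / sqrt (real d)"
  have h: "h > 0" using assms by (simp add: h_def)
  \<comment> \<open>Rounding towards 0 keeps the rounded point in the same \<open>\<ell>\<^sub>1\<close>-ball.\<close>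
  define k where "k = (\<lambda>i\<in>{..<d}. if \<beta> i \<ge> 0 then \<lfloor>\<beta> i / h\<rfloor> else \<lceil>\<beta> i / h\<rceil>)"
  have abs_k: "real_of_int \<bar>k i\<bar> \<le> \<bar>\<beta> i\<bar> / h" and
    dist_k: "\<bar>\<beta> i / h - real_of_int (k i)\<bar> \<le> 1" if "i < d" for i
  proof -
    have "real_of_int \<bar>k i\<bar> \<le> \<bar>\<beta> i\<bar> / h \<and> \<bar>\<beta> i / h - real_of_int (k i)\<bar> \<le> 1"
    proof (cases "\<beta> i \<ge> 0")
      case True
      then have "\<beta> i / h \<ge> 0" using h by simp
      then have "\<lfloor>\<beta> i / h\<rfloor> \<ge> 0" by simp
      then show ?thesis using that True by (simp add: k_def) linarith
    next
      case False
      then have "\<beta> i / h \<le> 0" using h by (simp add: divide_nonpos_pos)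
      then have "\<lceil>\<beta> i / h\<rceil> \<le> 0" by simp
      then show ?thesis using that False by (simp add: k_def) linarith
    qed
    then show "real_of_int \<bar>k i\<bar> \<le> \<bar>\<beta> i\<bar> / h" "\<bar>\<beta> i / h - real_of_int (k i)\<bar> \<le> 1" by auto
  qed
  have "(\<Sum>i<d. real_of_int \<bar>k i\<bar>) \<le> (\<Sum>i<d. \<bar>\<beta> i\<bar>) / h"
    unfolding sum_divide_distrib by (intro sum_mono abs_k) auto
  also have "\<dots> \<le> sqrt (real d) * 1 / h"
    using h sum_abs_le_sqrt_mult_L2_set[of \<beta> d] mult_left_mono[OF \<beta>, of "sqrt (real d)"]
    by (intro divide_right_mono) auto
  also have "\<dots> = real d / \<epsilon>" using assms by (simp add: h_def)
  finally have "k \<in> int_l1_ball d (real d / \<epsilon>)"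
    by (simp add: int_l1_ball_def k_def)
  then have mem: "(\<lambda>i. real_of_int (k i) * h) \<in> grid_net d \<epsilon>"
    by (auto simp: grid_net_def h_def)
  have "\<bar>\<beta> i - real_of_int (k i) * h\<bar> \<le> \<bar>h\<bar>" if "i < d" for i
  proof -
    have "\<beta> i - real_of_int (k i) * h = (\<beta> i / h - real_of_int (k i)) * h"
      using h by (simp add: field_simps)
    also have "\<bar>\<dots>\<bar> \<le> 1 * \<bar>h\<bar>"
      unfolding abs_mult using dist_k[OF that] by (intro mult_right_mono) auto
    finally show ?thesis by simp
  qed
  then have "(\<Sum>i<d. (\<beta> i - real_of_int (k i) * h)\<^sup>2) \<le> (\<Sum>i<d. h\<^sup>2)"
    by (intro sum_mono) (simp only: abs_le_square_iff lessThan_iff)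
  also have "\<dots> = \<epsilon>\<^sup>2" using d by (simp add: h_def power_divide)
  finally have "L2_set (\<lambda>i. \<beta> i - real_of_int (k i) * h) {..<d} \<le> \<epsilon>"
    using assms(1) by (simp add: L2_set_def real_le_lsqrt)
  then show ?thesis using mem by (intro bexI)
qed

subsection \<open>Empirical means as VSTAT answers\<close>

lemma exp_le_quadratic:
  fixes x :: real
  assumes "x \<le> 1"
  shows "exp x \<le> 1 + x + x\<^sup>2"
proof (cases "0 \<le> x")
  case True
  with assms show ?thesis by (rule exp_bound[rotated -1])
next
  case False
  define y where "y = - x"
  have y: "y > 0" using False by (simp add: y_def)
  \<comment> \<open>The claim amounts to \<open>1 \<le> (1 - y + y\<^sup>2) * exp y\<close>; it
    already holds with \<open>exp y\<close> replaced by its second Taylor polynomial, because every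
    term on the right is nonnegative.\<close>
  have "(1 - y + y\<^sup>2) * (1 + y + y\<^sup>2 / 2) = 1 + y\<^sup>2 / 2 + y ^ 3 / 2 + y ^ 4 / 2"
    by (simp add: power2_eq_square power3_eq_cube power4_eq_xxxx field_simps)
  then have "1 \<le> (1 - y + y\<^sup>2) * (1 + y + y\<^sup>2 / 2)" using y by simp
  also have "\<dots> \<le> (1 - y + y\<^sup>2) * exp y"
  proof (intro mult_left_mono)
    show "1 + y + y\<^sup>2 / 2 \<le> exp y" using exp_lower_Taylor_quadratic[of y] y by simp
    have "0 \<le> (1 - y)\<^sup>2 + y" using y by simp
    then show "0 \<le> 1 - y + y\<^sup>2" by (simp add: power2_eq_square algebra_simps)
  qed
  finally have "exp (- y) \<le> 1 - y + y\<^sup>2" by (simp add: exp_minus field_simps)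
  then show ?thesis by (simp add: y_def)
qed

text \<open>
  Bernstein's inequality, for the deviations \<open>t\<close> that a VSTAT(\<open>m\<close>) oracle tolerates when the
  variance is at most \<open>v\<close>.  The exponential moment is taken at \<open>1 / (2 m t)\<close>.
\<close>

lemma (in prob_space) bernstein_upper_tail:
  fixes g :: "'a \<Rightarrow> real"
  assumes g[measurable]: "g \<in> borel_measurable M"
    and bound: "\<And>z. z \<in> space M \<Longrightarrow> \<bar>g z\<bar> \<le> 1"
    and mean: "expectation g = 0" and var: "expectation (\<lambda>z. (g z)\<^sup>2) \<le> v"
    and m: "m > 0" and t: "1 / m \<le> t" "v \<le> m * t\<^sup>2"
  shows "measure (iid_samples n M) {s \<in> space (iid_samples n M). real n * t \<le> (\<Sum>i<n. g (s i))}
    \<le> exp (- real n / (4 * m))"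
proof -
  interpret P: product_prob_space "\<lambda>_. M" "{..<n}" ..
  let ?S = "iid_samples n M"
  interpret S: prob_space ?S
    unfolding iid_samples_def by (rule P.prob_space_axioms)
  have [measurable]: "(\<lambda>s. s i) \<in> measurable ?S M" if "i < n" for i
    unfolding iid_samples_def using that by (intro measurable_component_singleton) auto
  have t0: "t > 0" using m t(1) by (meson less_le_trans zero_less_divide_1_iff)
  \<comment> \<open>This minimises \<open>\<theta>\<^sup>2 * m * t\<^sup>2 - \<theta> * t\<close>,
    with value \<open>- 1 / (4 * m)\<close>. The condition \<open>1 / m \<le> t\<close> keeps it at
    most 1, as the quadratic bound on \<open>exp\<close> requires.\<close>
  define \<theta> where "\<theta> = 1 / (2 * m * t)"
  have \<theta>: "0 < \<theta>" "\<theta> \<le> 1"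
    using m t t0 by (auto simp: \<theta>_def field_simps)
  have int_g: "integrable M g" "integrable M (\<lambda>z. (g z)\<^sup>2)"
    by (rule integrable_const_bound[of _ 1]; use bound in \<open>auto simp: abs_square_le_1\<close>)+
  have le: "exp (\<theta> * g z) \<le> 1 + \<theta> * g z + \<theta>\<^sup>2 * (g z)\<^sup>2" if "z \<in> space M" for z
  proof -
    have "\<theta> * g z \<le> 1 * 1"
      using \<theta> bound[OF that] by (smt (verit) mult_left_le mult_mono')
    then show ?thesis using exp_le_quadratic[of "\<theta> * g z"] by (simp add: power_mult_distrib)
  qed
  have "(\<integral>\<^sup>+ z. ennreal (exp (\<theta> * g z)) \<partial>M) \<le> (\<integral>\<^sup>+ z. ennreal (1 + \<theta> * g z + \<theta>\<^sup>2 * (g z)\<^sup>2) \<partial>M)"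
    by (intro nn_integral_mono ennreal_leI le)
  also have "\<dots> = ennreal (\<integral>z. 1 + \<theta> * g z + \<theta>\<^sup>2 * (g z)\<^sup>2 \<partial>M)"
    by (intro nn_integral_eq_integral AE_I2)
      (use int_g in simp, meson le exp_ge_zero order_trans)
  also have "(\<integral>z. 1 + \<theta> * g z + \<theta>\<^sup>2 * (g z)\<^sup>2 \<partial>M) = 1 + \<theta>\<^sup>2 * expectation (\<lambda>z. (g z)\<^sup>2)"
    using int_g by (simp add: mean prob_space)
  also have "ennreal \<dots> \<le> ennreal (exp (\<theta>\<^sup>2 * v))"
  proof (rule ennreal_leI)
    have "1 + \<theta>\<^sup>2 * expectation (\<lambda>z. (g z)\<^sup>2) \<le> 1 + \<theta>\<^sup>2 * v"
      using var by (simp add: mult_left_mono)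
    also have "\<dots> \<le> exp (\<theta>\<^sup>2 * v)" by (rule exp_ge_add_one_self)
    finally show "1 + \<theta>\<^sup>2 * expectation (\<lambda>z. (g z)\<^sup>2) \<le> exp (\<theta>\<^sup>2 * v)" .
  qed
  finally have mgf: "(\<integral>\<^sup>+ z. ennreal (exp (\<theta> * g z)) \<partial>M) \<le> ennreal (exp (\<theta>\<^sup>2 * v))" .
  \<comment> \<open>The Markov factor \<open>exp (- \<theta> * n * t)\<close> is spread over the
    samples, one \<open>?c\<close> each, so that the dominating function is a product and
    independence factorises its integral.\<close>
  let ?c = "exp (- \<theta> * t)"
  have "emeasure ?S {s \<in> space ?S. real n * t \<le> (\<Sum>i<n. g (s i))}
      = (\<integral>\<^sup>+ s. indicator {s \<in> space ?S. real n * t \<le> (\<Sum>i<n. g (s i))} s \<partial>?S)"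
    by (intro nn_integral_indicator[symmetric]) measurable
  also have "\<dots> \<le> (\<integral>\<^sup>+ s. (\<Prod>i<n. ennreal ?c * ennreal (exp (\<theta> * g (s i)))) \<partial>?S)"
  proof (intro nn_integral_mono)
    fix s
    have "(\<Prod>i<n. ennreal ?c * ennreal (exp (\<theta> * g (s i)))) = ennreal (exp (\<theta> * ((\<Sum>i<n. g (s i)) - real n * t)))"
      by (simp add: prod_ennreal algebra_simps sum_distrib_left sum_subtractf
          flip: ennreal_mult exp_add exp_sum)
    then show "indicator {s \<in> space ?S. real n * t \<le> (\<Sum>i<n. g (s i))} s
        \<le> (\<Prod>i<n. ennreal ?c * ennreal (exp (\<theta> * g (s i))))"
      using \<theta> by (auto simp: indicator_def)
  qed
  also have "\<dots> = (\<Prod>i<n. \<integral>\<^sup>+ z. ennreal ?c * ennreal (exp (\<theta> * g z)) \<partial>M)"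
    unfolding iid_samples_def by (intro P.product_nn_integral_prod) auto
  also have "\<dots> \<le> (\<Prod>i<n. ennreal ?c * ennreal (exp (\<theta>\<^sup>2 * v)))"
    by (subst nn_integral_cmult; (intro prod_mono_ennreal mult_left_mono mgf)?) auto
  also have "\<dots> = ennreal (exp (real n * (\<theta>\<^sup>2 * v - \<theta> * t)))"
    by (simp add: ennreal_power algebra_simps flip: ennreal_mult exp_add exp_of_nat_mult)
  also have "\<dots> \<le> ennreal (exp (- real n / (4 * m)))"
  proof (intro ennreal_leI, simp)
    have "\<theta>\<^sup>2 * v \<le> \<theta>\<^sup>2 * (m * t\<^sup>2)" using t by (intro mult_left_mono) auto
    also have "\<dots> = 1 / (4 * m)" using m t0 by (simp add: \<theta>_def power2_eq_square field_simps)
    finally have "\<theta>\<^sup>2 * v - \<theta> * t \<le> 1 / (4 * m) - 1 / (2 * m)" using t0 by (simp add: \<theta>_def)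
    also have "\<dots> = - 1 / (4 * m)" using m by (simp add: field_simps)
    finally have "real n * (\<theta>\<^sup>2 * v - \<theta> * t) \<le> real n * (- 1 / (4 * m))" by (intro mult_left_mono) auto
    then show "real n * (\<theta>\<^sup>2 * v - \<theta> * t) \<le> - (real n / (4 * m))" by simp
  qed
  finally show ?thesis by (simp add: S.emeasure_eq_measure)
qed

definition empirical_mean :: "nat \<Rightarrow> (nat \<Rightarrow> 'x) \<Rightarrow> ('x \<Rightarrow> real) \<Rightarrow> real" where
  "empirical_mean n s f = (\<Sum>i<n. f (s i)) / real n"

lemma measurable_empirical_mean:
  assumes [measurable]: "f \<in> borel_measurable D"
  shows "(\<lambda>s. empirical_mean n s f) \<in> borel_measurable (iid_samples n D)"
proof -
  have [measurable]: "(\<lambda>s. s i) \<in> measurable (iid_samples n D) D" if "i < n" for i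
    unfolding iid_samples_def using that by (intro measurable_component_singleton) auto
  show ?thesis unfolding empirical_mean_def by measurable
qed

lemma measurable_empirical_mean_vstat:
  assumes "f \<in> borel_measurable D"
  shows "{s \<in> space (iid_samples n D). empirical_mean n s f \<in> vstat m D f} \<in> sets (iid_samples n D)"
proof -
  note [measurable] = measurable_empirical_mean[OF assms, of n]
  show ?thesis unfolding vstat_def Let_def by measurable
qed

text \<open>As \<open>f\<^sup>2 \<le> f\<close> for values in [0,1], the variance is at most
  \<open>p * (1 - p)\<close>. The two branches of the VSTAT tolerance are then exactly the two
  conditions on \<open>t\<close> in Bernstein's inequality, which is applied to \<open>f - p\<close>
  and to its negative.\<close>

lemma prob_empirical_mean_not_vstat_le:
  assumes D: "prob_space D" and f[measurable]: "f \<in> borel_measurable D"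
    and f01: "\<And>z. z \<in> space D \<Longrightarrow> f z \<in> {0..1}"
    and m: "m > 0" and n: "n > 0"
  shows "measure (iid_samples n D) {s \<in> space (iid_samples n D). empirical_mean n s f \<notin> vstat m D f}
    \<le> 2 * exp (- real n / (4 * real m))"
proof -
  interpret prob_space D by (rule D)
  let ?S = "iid_samples n D"
  interpret S: prob_space ?S
    unfolding iid_samples_def by (intro prob_space_PiM D)
  have [measurable]: "(\<lambda>s. s i) \<in> measurable ?S D" if "i < n" for i
    unfolding iid_samples_def using that by (intro measurable_component_singleton) auto
  define p where "p = expectation f"
  define t where "t = max (1 / real m) (sqrt (p * (1 - p) / real m))"
  have int: "integrable D f" "integrable D (\<lambda>z. (f z)\<^sup>2)"
    by (rule integrable_const_bound[of _ 1]; use f01 in \<open>auto simp: power_le_one\<close>)+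
  have p: "0 \<le> p" "p \<le> 1"
    using integral_mono[OF int(1), of "\<lambda>_. 1"] integral_nonneg_AE[of f D] f01
    by (auto simp: p_def prob_space)
  have "expectation (\<lambda>z. (f z - p)\<^sup>2) = expectation (\<lambda>z. (f z)\<^sup>2) - p\<^sup>2"
    using int by (simp add: power2_diff prob_space p_def) (simp add: power2_eq_square)
  also have "expectation (\<lambda>z. (f z)\<^sup>2) \<le> p"
    unfolding p_def using int f01
    by (intro integral_mono) (auto simp: power2_eq_square mult_left_le)
  finally have var: "expectation (\<lambda>z. (f z - p)\<^sup>2) \<le> p * (1 - p)"
    by (simp add: power2_eq_square algebra_simps)
  have "p * (1 - p) / real m = (sqrt (p * (1 - p) / real m))\<^sup>2"
    using p by simp
  also have "\<dots> \<le> t\<^sup>2" using p by (intro power_mono) (auto simp: t_def)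
  finally have t2: "p * (1 - p) \<le> real m * t\<^sup>2" using m by (simp add: field_simps)
  have t1: "1 / real m \<le> t" by (simp add: t_def)
  have bound: "\<bar>f z - p\<bar> \<le> 1" if "z \<in> space D" for z
    using f01[OF that] p by auto
  let ?U = "{s \<in> space ?S. real n * t \<le> (\<Sum>i<n. f (s i) - p)}"
  let ?L = "{s \<in> space ?S. real n * t \<le> (\<Sum>i<n. - (f (s i) - p))}"
  have U: "measure ?S ?U \<le> exp (- real n / (4 * real m))"
    using int m by (intro bernstein_upper_tail[OF _ _ _ var _ t1 t2] bound)
      (auto simp: prob_space p_def)
  have L: "measure ?S ?L \<le> exp (- real n / (4 * real m))"
    using int m var bound by (intro bernstein_upper_tail[OF _ _ _ _ _ t1 t2])
      (auto simp: prob_space p_def abs_minus_commute power2_commute)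
  have "measure ?S {s \<in> space ?S. empirical_mean n s f \<notin> vstat m D f} \<le> measure ?S (?U \<union> ?L)"
  proof (rule S.finite_measure_mono)
    have emp: "real n * (empirical_mean n s f - p) = (\<Sum>i<n. f (s i) - p)" for s
      using n by (simp add: empirical_mean_def sum_subtractf right_diff_distrib)
    show "{s \<in> space ?S. empirical_mean n s f \<notin> vstat m D f} \<subseteq> ?U \<union> ?L"
    proof safe
      fix s assume s: "s \<in> space ?S" "empirical_mean n s f \<notin> vstat m D f"
        and L: "\<not> real n * t \<le> (\<Sum>i<n. - (f (s i) - p))"
      have "t < \<bar>empirical_mean n s f - p\<bar>"
        using s(2) unfolding vstat_def Let_def p_def[symmetric] t_def by (simp only: mem_Collect_eq not_le)
      then have "real n * t \<le> \<bar>real n * (empirical_mean n s f - p)\<bar>"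
        using n by (simp add: abs_mult)
      then show "real n * t \<le> (\<Sum>i<n. f (s i) - p)"
        using L unfolding emp sum_negf by linarith
    qed
    show "?U \<union> ?L \<in> sets ?S" by measurable
  qed
  also have "\<dots> \<le> measure ?S ?U + measure ?S ?L"
    by (intro measure_Un_le) measurable
  finally show ?thesis using U L by linarith
qed

subsection \<open>Residuals in the regression model\<close>

lemma prob_space_std_normal: "prob_space (density lborel std_normal_density)"
  by (rule prob_space_normal_density) simp

lemma prob_space_std_gaussian: "prob_space (std_gaussian d)"
  unfolding std_gaussian_def by (intro prob_space_PiM prob_space_std_normal)

lemma sets_std_gaussian: "sets (std_gaussian d) = sets (\<Pi>\<^sub>M i\<in>{..<d}. (borel :: real measure))"
  unfolding std_gaussian_def by (intro sets_PiM_cong) auto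

lemma measurable_std_gaussian_component [measurable]:
  "i < d \<Longrightarrow> (\<lambda>x. x i) \<in> borel_measurable (std_gaussian d)"
  by (subst measurable_cong_sets[OF sets_std_gaussian refl]) simp

lemma distributed_std_gaussian_component:
  assumes "i < d"
  shows "distributed (std_gaussian d) lborel (\<lambda>x. x i) std_normal_density"
proof -
  have "distr (std_gaussian d) lborel (\<lambda>x. x i)
      = distr (std_gaussian d) (density lborel std_normal_density) (\<lambda>x. x i)"
    by (intro distr_cong) auto
  also have "\<dots> = density lborel std_normal_density"
    unfolding std_gaussian_def using assms
    by (intro distr_PiM_component prob_space_std_normal) auto
  finally show ?thesis using assms by (simp add: distributed_def)
qed

text \<open>Independence is read off the joint law: it is \<open>std_gaussian d\<close> itself, the
  product of the marginals. This characterisation asks for a nonempty index set.\<close>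

lemma indep_std_gaussian_components:
  assumes "1 \<le> d"
  shows "prob_space.indep_vars (std_gaussian d) (\<lambda>_. borel) (\<lambda>i x. x i) {..<d}"
proof -
  interpret prob_space "std_gaussian d" by (rule prob_space_std_gaussian)
  have "distr (std_gaussian d) (\<Pi>\<^sub>M i\<in>{..<d}. borel) (\<lambda>x. \<lambda>i\<in>{..<d}. x i)
      = distr (std_gaussian d) (std_gaussian d) (\<lambda>x. x)"
    by (intro distr_cong sets_std_gaussian[symmetric])
      (simp_all add: std_gaussian_def space_PiM PiE_restrict)
  also have "\<dots> = std_gaussian d" by simp
  also have "\<dots> = (\<Pi>\<^sub>M i\<in>{..<d}. distr (std_gaussian d) borel (\<lambda>x. x i))"
  proof -
    have "density lborel std_normal_density = distr (std_gaussian d) borel (\<lambda>x. x i)" if "i < d" for i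
    proof -
      have "distr (std_gaussian d) borel (\<lambda>x. x i) = distr (std_gaussian d) lborel (\<lambda>x. x i)"
        by (intro distr_cong) auto
      then show ?thesis
        using distributed_distr_eq_density[OF distributed_std_gaussian_component[OF that]] by simp
    qed
    then show ?thesis by (subst std_gaussian_def) (rule PiM_cong[OF refl], simp)
  qed
  finally show ?thesis
    using assms by (subst indep_vars_iff_distr_eq_PiM') (auto simp: lessThan_empty_iff)
qed

lemma distributed_std_gaussian_linear_form:
  assumes pos: "L2_set v {..<d} > 0"
  shows "distributed (std_gaussian d) lborel (\<lambda>x. \<Sum>i<d. x i * v i) (normal_density 0 (L2_set v {..<d}))"
proof -
  interpret prob_space "std_gaussian d" by (rule prob_space_std_gaussian)
  \<comment> \<open>Coordinates with coefficient 0 are dropped, since the sum rule for independent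
    normals needs positive standard deviations. Positivity of the norm makes \<open>I\<close>
    nonempty.\<close>
  define I where "I = {i \<in> {..<d}. v i \<noteq> 0}"
  have sq: "(\<Sum>i\<in>I. \<bar>v i\<bar>\<^sup>2) = (\<Sum>i<d. (v i)\<^sup>2)"
    by (simp add: I_def) (intro sum.mono_neutral_left, auto)
  have "I \<noteq> {}"
  proof
    assume "I = {}"
    then have "L2_set v {..<d} = 0" by (auto simp: I_def L2_set_eq_0_iff)
    with pos show False by simp
  qed
  then have d: "1 \<le> d" by (auto simp: I_def)
  have "distributed (std_gaussian d) lborel (\<lambda>x. \<Sum>i\<in>I. v i * x i)
      (normal_density (\<Sum>i\<in>I. 0) (sqrt (\<Sum>i\<in>I. \<bar>v i\<bar>\<^sup>2)))"
  proof (rule sum_indep_normal)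
    show "indep_vars (\<lambda>_. borel) (\<lambda>i x. v i * x i) I"
      by (rule indep_vars_compose2[OF indep_vars_subset[OF indep_std_gaussian_components[OF d]]])
        (auto simp: I_def)
    show "distributed (std_gaussian d) lborel (\<lambda>x. v i * x i) (normal_density 0 \<bar>v i\<bar>)" if "i \<in> I" for i
      using normal_density_affine[OF distributed_std_gaussian_component[of i d], of "v i" 0] that
      by (simp add: I_def)
  qed (use \<open>I \<noteq> {}\<close> in \<open>auto simp: I_def\<close>)
  moreover have "(\<Sum>i\<in>I. v i * x i) = (\<Sum>i<d. x i * v i)" for x
    by (simp add: I_def mult.commute) (intro sum.mono_neutral_left, auto)
  ultimately show ?thesis by (simp only: sq L2_set_def sum.neutral_const)
qed

text \<open>The linear form must fall into an interval of length \<open>2 * r\<close>, and its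
  density is at most \<open>1 / (2 * s)\<close> for \<open>s\<close> the norm of \<open>v\<close>,
  because \<open>sqrt (2 * pi) \<ge> 2\<close>. The shift \<open>c\<close> will be the value of the
  noise.\<close>

lemma std_gaussian_anticoncentration:
  assumes pos: "L2_set v {..<d} > 0" and r: "r \<ge> 0"
  shows "measure (std_gaussian d) {x \<in> space (std_gaussian d). \<bar>(\<Sum>i<d. x i * v i) + c\<bar> \<le> r}
    \<le> r / L2_set v {..<d}"
proof -
  interpret prob_space "std_gaussian d" by (rule prob_space_std_gaussian)
  let ?s = "L2_set v {..<d}" and ?I = "{- r - c..r - c}"
  note D = distributed_std_gaussian_linear_form[OF pos]
  have dens: "normal_density 0 ?s x \<le> 1 / (2 * ?s)" for x
  proof -
    have "2 \<le> sqrt (2 * pi)" using pi_gt3 by (intro real_le_rsqrt) auto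
    then have "2 * ?s \<le> sqrt (2 * pi * ?s\<^sup>2)"
      using pos by (simp add: real_sqrt_mult)
    then have "1 / sqrt (2 * pi * ?s\<^sup>2) \<le> 1 / (2 * ?s)"
      using pos by (intro divide_left_mono) auto
    moreover have "exp (- (x - 0)\<^sup>2 / (2 * ?s\<^sup>2)) \<le> 1" by simp
    ultimately have "1 / sqrt (2 * pi * ?s\<^sup>2) * exp (- (x - 0)\<^sup>2 / (2 * ?s\<^sup>2)) \<le> 1 / (2 * ?s) * 1"
      using pos by (intro mult_mono) auto
    then show ?thesis by (simp add: normal_density_def)
  qed
  have "emeasure (std_gaussian d) {x \<in> space (std_gaussian d). \<bar>(\<Sum>i<d. x i * v i) + c\<bar> \<le> r}
      = emeasure (std_gaussian d) ((\<lambda>x. \<Sum>i<d. x i * v i) -` ?I \<inter> space (std_gaussian d))"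
    by (rule arg_cong[where f="emeasure (std_gaussian d)"]) (auto simp: abs_le_iff)
  also have "\<dots> = (\<integral>\<^sup>+ x. ennreal (normal_density 0 ?s x) * indicator ?I x \<partial>lborel)"
    by (rule distributed_emeasure[OF D]) auto
  also have "\<dots> \<le> (\<integral>\<^sup>+ x. ennreal (1 / (2 * ?s)) * indicator ?I x \<partial>lborel)"
    by (intro nn_integral_mono mult_right_mono ennreal_leI dens) auto
  also have "\<dots> = ennreal (1 / (2 * ?s)) * ennreal (2 * r)"
    using r by (subst nn_integral_cmult_indicator) auto
  also have "\<dots> = ennreal (r / ?s)"
    using r pos by (subst ennreal_mult[symmetric]) auto
  finally show ?thesis
    using r pos by (simp add: emeasure_eq_measure)
qed

text \<open>Chebyshev's inequality at no less than four standard deviations. The zero vector is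
  treated apart, as its linear form has no density.\<close>

lemma std_gaussian_concentration:
  assumes \<epsilon>: "\<epsilon> > 0" and v: "L2_set v {..<d} \<le> \<epsilon>"
  shows "measure (std_gaussian d) {x \<in> space (std_gaussian d). \<bar>\<Sum>i<d. x i * v i\<bar> \<le> 4 * \<epsilon>} \<ge> 15 / 16"
proof (cases "L2_set v {..<d} = 0")
  interpret prob_space "std_gaussian d" by (rule prob_space_std_gaussian)
  case True
  then have "v i = 0" if "i < d" for i using that by (simp add: L2_set_eq_0_iff)
  then have "(\<Sum>i<d. x i * v i) = 0" for x by (intro sum.neutral) simp
  then show ?thesis using \<epsilon> by (simp add: prob_space)
next
  interpret prob_space "std_gaussian d" by (rule prob_space_std_gaussian)
  case False
  let ?s = "L2_set v {..<d}"
  let ?X = "\<lambda>x. \<Sum>i<d. x i * v i"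
  have pos: "?s > 0" using False L2_set_nonneg[of v "{..<d}"] by linarith
  note D = distributed_std_gaussian_linear_form[OF pos]
  have mean: "expectation ?X = 0" by (rule normal_distributed_expectation[OF pos D])
  have var: "variance ?X = ?s\<^sup>2" by (rule normal_distributed_variance[OF pos D])
  have int: "integrable (std_gaussian d) (\<lambda>x. (?X x)\<^sup>2)"
  \<comment> \<open>A non-integrable function has Bochner integral 0 by convention, whereas the
    variance is known to be positive.\<close>
  proof (rule ccontr)
    assume "\<not> ?thesis"
    then have "(\<integral>x. (?X x)\<^sup>2 \<partial>std_gaussian d) = 0" by (rule not_integrable_integral_eq)
    with var mean pos show False by simp
  qed
  have "prob {x \<in> space (std_gaussian d). \<bar>?X x - expectation ?X\<bar> \<ge> 4 * \<epsilon>} \<le> variance ?X / (4 * \<epsilon>)\<^sup>2"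
    using \<epsilon> by (intro Chebyshev_inequality int) auto
  also have "\<dots> \<le> 1 / 16"
    using \<epsilon> power_mono[OF v, of 2] pos by (simp add: var power_mult_distrib field_simps)
  finally have tail: "prob {x \<in> space (std_gaussian d). \<bar>?X x\<bar> \<ge> 4 * \<epsilon>} \<le> 1 / 16"
    by (simp add: mean)
  have "1 - prob {x \<in> space (std_gaussian d). \<bar>?X x\<bar> \<ge> 4 * \<epsilon>}
      = prob (space (std_gaussian d) - {x \<in> space (std_gaussian d). \<bar>?X x\<bar> \<ge> 4 * \<epsilon>})"
    by (rule prob_compl[symmetric]) measurable
  also have "\<dots> \<le> prob {x \<in> space (std_gaussian d). \<bar>?X x\<bar> \<le> 4 * \<epsilon>}"
    by (rule finite_measure_mono; measurable?) auto
  finally show ?thesis using tail by linarith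
qed

section \<open>Acceptance probability of a candidate\<close>

definition residual_query :: "nat \<Rightarrow> real \<Rightarrow> (nat \<Rightarrow> real) \<Rightarrow> point \<Rightarrow> real" where
  "residual_query d r b = indicator {z. \<bar>snd z - (\<Sum>i<d. fst z i * b i)\<bar> \<le> r}"

lemma residual_query_in_01: "residual_query d r b z \<in> {0..1}"
  by (simp add: residual_query_def indicator_def)

lemma measurable_data_space_fst_component [measurable]:
  "i < d \<Longrightarrow> (\<lambda>z. fst z i) \<in> borel_measurable (data_space d)"
  unfolding data_space_def by measurable

lemma measurable_data_space_snd [measurable]: "snd \<in> borel_measurable (data_space d)"
  unfolding data_space_def by measurable

lemma measurable_residual_query [measurable]:
  "residual_query d r b \<in> borel_measurable (data_space d)"
proof -
  have "residual_query d r b = (\<lambda>z. if \<bar>snd z - (\<Sum>i<d. fst z i * b i)\<bar> \<le> r then 1 else 0)"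
    by (auto simp: residual_query_def indicator_def)
  also have "\<dots> \<in> borel_measurable (data_space d)" by measurable
  finally show ?thesis .
qed

lemma measurable_regression_map:
  assumes "sets E = sets borel"
  shows "(\<lambda>(x, z). (x, (\<Sum>i<d. x i * \<beta> i) + z)) \<in> measurable (std_gaussian d \<Otimes>\<^sub>M E) (data_space d)"
proof -
  have *: "sets (std_gaussian d \<Otimes>\<^sub>M E) = sets ((\<Pi>\<^sub>M i\<in>{..<d}. (borel :: real measure)) \<Otimes>\<^sub>M borel)"
    by (intro sets_pair_measure_cong sets_std_gaussian assms)
  show ?thesis
    unfolding data_space_def measurable_cong_sets[OF * refl] by measurable
qed

lemma prob_space_regression_dist:
  assumes "prob_space E" "sets E = sets borel"
  shows "prob_space (regression_dist d \<beta> E)"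
proof -
  interpret G: prob_space "std_gaussian d" by (rule prob_space_std_gaussian)
  interpret E: prob_space E by fact
  interpret pair_prob_space "std_gaussian d" E ..
  show ?thesis
    unfolding regression_dist_def by (intro prob_space_distr measurable_regression_map assms)
qed

lemma sets_regression_dist: "sets (regression_dist d \<beta> E) = sets (data_space d)"
  by (simp add: regression_dist_def)

text \<open>Change of variables to the product space, where the Gaussian part of the residual and
  the noise are independent coordinates.\<close>

lemma integral_residual_query:
  assumes E: "prob_space E" and sets_E: "sets E = sets borel"
  shows "(\<integral>z. residual_query d r b z \<partial>regression_dist d \<beta> E)
    = measure (std_gaussian d \<Otimes>\<^sub>M E)
        {w \<in> space (std_gaussian d \<Otimes>\<^sub>M E). \<bar>(\<Sum>i<d. fst w i * (\<beta> i - b i)) + snd w\<bar> \<le> r}" (is "_ = measure ?P ?W")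
proof -
  have "(\<integral>z. residual_query d r b z \<partial>regression_dist d \<beta> E)
      = (\<integral>w. residual_query d r b (case w of (x, z) \<Rightarrow> (x, (\<Sum>i<d. x i * \<beta> i) + z)) \<partial>?P)"
    unfolding regression_dist_def
    by (intro integral_distr measurable_regression_map sets_E measurable_residual_query)
  also have "\<dots> = (\<integral>w. indicator ?W w \<partial>?P)"
    by (intro Bochner_Integration.integral_cong)
      (auto simp: residual_query_def indicator_def sum_subtractf right_diff_distrib algebra_simps)
  also have "\<dots> = measure ?P ?W"
    by simp (rule arg_cong[where f = "measure ?P"], blast)
  finally show ?thesis .
qed

lemma measurable_residual_event:
  assumes "sets E = sets borel"
  shows "{w \<in> space (std_gaussian d \<Otimes>\<^sub>M E). \<bar>(\<Sum>i<d. fst w i * v i) + snd w\<bar> \<le> r} \<in> sets (std_gaussian d \<Otimes>\<^sub>M E)"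
proof -
  have [measurable]: "snd \<in> borel_measurable (std_gaussian d \<Otimes>\<^sub>M E)"
    using measurable_snd[of "std_gaussian d" E] measurable_cong_sets[OF refl assms] by blast
  have [measurable]: "(\<lambda>w. fst w i) \<in> borel_measurable (std_gaussian d \<Otimes>\<^sub>M E)" if "i < d" for i
    using that by (intro measurable_compose[OF measurable_fst measurable_std_gaussian_component])
  show ?thesis by measurable
qed

text \<open>The event contains the rectangle on which the Gaussian part is at most
  \<open>4 * \<epsilon>\<close> and the noise is 0; its measure is a product.\<close>

lemma integral_residual_query_ge:
  assumes noise: "oblivious_noise \<alpha> E" and \<epsilon>: "\<epsilon> > 0" and \<alpha>: "\<alpha> \<ge> 0"
    and near: "L2_set (\<lambda>i. \<beta> i - b i) {..<d} \<le> \<epsilon>"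
  shows "(\<integral>z. residual_query d (4 * \<epsilon>) b z \<partial>regression_dist d \<beta> E) \<ge> 15 / 16 * \<alpha>"
proof -
  have E: "prob_space E" "sets E = sets borel" "measure E {0} \<ge> \<alpha>"
    using noise by (auto simp: oblivious_noise_def)
  interpret G: prob_space "std_gaussian d" by (rule prob_space_std_gaussian)
  interpret E: prob_space E by fact
  interpret P: pair_prob_space "std_gaussian d" E ..
  let ?A = "{x \<in> space (std_gaussian d). \<bar>\<Sum>i<d. x i * (\<beta> i - b i)\<bar> \<le> 4 * \<epsilon>}"
  let ?W = "{w \<in> space (std_gaussian d \<Otimes>\<^sub>M E). \<bar>(\<Sum>i<d. fst w i * (\<beta> i - b i)) + snd w\<bar> \<le> 4 * \<epsilon>}"
  have A: "?A \<in> sets (std_gaussian d)" by measurable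
  have "15 / 16 * \<alpha> \<le> measure (std_gaussian d) ?A * measure E {0}"
    using E(3) \<alpha> by (intro mult_mono std_gaussian_concentration[OF \<epsilon> near]) auto
  also have "\<dots> = measure (std_gaussian d \<Otimes>\<^sub>M E) (?A \<times> {0})"
    using A E by (simp add: measure_def E.emeasure_pair_measure_Times enn2real_mult)
  also have "\<dots> \<le> measure (std_gaussian d \<Otimes>\<^sub>M E) ?W"
  proof (rule P.finite_measure_mono)
    show "?A \<times> {0} \<subseteq> ?W"
      using sets_eq_imp_space_eq[OF E(2)] by (auto simp: space_pair_measure)
  qed (rule measurable_residual_event[OF E(2)])
  finally show ?thesis by (simp add: integral_residual_query[OF E(1,2)])
qed

text \<open>By Fubini, condition on the noise value \<open>z\<close>. Anticoncentration is uniform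
  in the shift \<open>z\<close>, so it survives integration over any law of the noise.\<close>

lemma integral_residual_query_le:
  assumes E: "prob_space E" "sets E = sets borel" and r: "r \<ge> 0"
    and far: "L2_set (\<lambda>i. \<beta> i - b i) {..<d} > 0"
  shows "(\<integral>z. residual_query d r b z \<partial>regression_dist d \<beta> E) \<le> r / L2_set (\<lambda>i. \<beta> i - b i) {..<d}"
proof -
  interpret G: prob_space "std_gaussian d" by (rule prob_space_std_gaussian)
  interpret E: prob_space E by fact
  interpret P: pair_prob_space "std_gaussian d" E ..
  let ?W = "{w \<in> space (std_gaussian d \<Otimes>\<^sub>M E). \<bar>(\<Sum>i<d. fst w i * (\<beta> i - b i)) + snd w\<bar> \<le> r}"
  let ?s = "L2_set (\<lambda>i. \<beta> i - b i) {..<d}"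
  have "emeasure (std_gaussian d \<Otimes>\<^sub>M E) ?W = (\<integral>\<^sup>+ z. emeasure (std_gaussian d) ((\<lambda>x. (x, z)) -` ?W) \<partial>E)"
    by (intro P.emeasure_pair_measure_alt2 measurable_residual_event E)
  also have "\<dots> \<le> (\<integral>\<^sup>+ z. ennreal (r / ?s) \<partial>E)"
  proof (intro nn_integral_mono)
    fix z assume "z \<in> space E"
    then have "(\<lambda>x. (x, z)) -` ?W = {x \<in> space (std_gaussian d). \<bar>(\<Sum>i<d. x i * (\<beta> i - b i)) + z\<bar> \<le> r}"
      by (auto simp: space_pair_measure)
    then show "emeasure (std_gaussian d) ((\<lambda>x. (x, z)) -` ?W) \<le> ennreal (r / ?s)"
      using std_gaussian_anticoncentration[OF far r, of z]
      by (simp add: G.emeasure_eq_measure ennreal_leI)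
  qed
  also have "\<dots> = ennreal (r / ?s)" by (simp add: E.emeasure_space_1)
  finally have "measure (std_gaussian d \<Otimes>\<^sub>M E) ?W \<le> r / ?s"
    using r far by (simp add: P.emeasure_eq_measure)
  then show ?thesis by (simp add: integral_residual_query[OF E])
qed

subsection \<open>Searching for an accepted candidate\<close>

text \<open>Answers decide only when to stop, never what is asked next, so all queries come from a
  fixed finite family. The default \<open>b\<^sub>0\<close> is returned only if every answer falls
  below \<open>\<theta>\<close>.\<close>

primrec search :: "('b \<Rightarrow> 'x \<Rightarrow> real) \<Rightarrow> real \<Rightarrow> 'b \<Rightarrow> 'b list \<Rightarrow> ('x, 'b) sq_alg" where
  "search Q \<theta> b\<^sub>0 [] = Output b\<^sub>0"
| "search Q \<theta> b\<^sub>0 (b # bs) = Query (Q b) (\<lambda>u. if \<theta> \<le> u then Output b else search Q \<theta> b\<^sub>0 bs)"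

lemma valid_queries_search:
  assumes "\<And>b. b \<in> set bs \<Longrightarrow> Q b \<in> borel_measurable S"
    and "\<And>b z. b \<in> set bs \<Longrightarrow> z \<in> space S \<Longrightarrow> Q b z \<in> {0..1}"
  shows "valid_queries S (search Q \<theta> b\<^sub>0 bs)"
  using assms by (induction bs) auto

lemma at_most_queries_search: "at_most_queries (search Q \<theta> b\<^sub>0 bs) (length bs)"
  by (induction bs) auto

text \<open>A candidate that passes under every valid answer stops the search at its position at the
  latest, which excludes the default. The output itself passed under some valid answer, which is all
  that an adversarial oracle guarantees.\<close>

lemma vstat_outputs_search:
  assumes "\<exists>b\<in>set bs. \<forall>u\<in>vstat m D (Q b). \<theta> \<le> u"
    and "x \<in> vstat_outputs m D (search Q \<theta> b\<^sub>0 bs)"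
  shows "x \<in> set bs \<and> (\<exists>u\<in>vstat m D (Q x). \<theta> \<le> u)"
  using assms by (induction bs) (auto split: if_splits)

lemma vstat_run_search:
  assumes "\<And>b. b \<in> set bs \<Longrightarrow> orc (Q b) \<in> vstat m D (Q b)"
  shows "vstat_run m D orc (search Q \<theta> b\<^sub>0 bs)"
  using assms by (induction bs) auto

text \<open>Needed because \<open>simulates_vstat\<close> applies \<open>measure\<close>. The run is
  valid iff the first answer is valid and either the search stops there or the remaining run is
  valid.\<close>

lemma measurable_vstat_run_search:
  assumes "\<And>b. b \<in> set bs \<Longrightarrow> Q b \<in> borel_measurable D"
  shows "{s \<in> space (iid_samples n D). vstat_run m D (empirical_mean n s) (search Q \<theta> b\<^sub>0 bs)}
    \<in> sets (iid_samples n D)"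
  using assms
proof (induction bs)
  case (Cons b bs)
  let ?S = "iid_samples n D"
  let ?V = "{s \<in> space ?S. empirical_mean n s (Q b) \<in> vstat m D (Q b)}"
  let ?T = "{s \<in> space ?S. \<theta> \<le> empirical_mean n s (Q b)}"
  let ?R = "{s \<in> space ?S. vstat_run m D (empirical_mean n s) (search Q \<theta> b\<^sub>0 bs)}"
  have Qb: "Q b \<in> borel_measurable D" using Cons.prems by simp
  note [measurable] = measurable_empirical_mean[OF Qb, of n]
  have "?V \<in> sets ?S" by (rule measurable_empirical_mean_vstat[OF Qb])
  moreover have "?T \<in> sets ?S" by measurable
  moreover have "?R \<in> sets ?S" using Cons by simp
  ultimately have "?V \<inter> (?T \<union> ?R) \<in> sets ?S" by blast
  also have "?V \<inter> (?T \<union> ?R) =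
      {s \<in> space ?S. vstat_run m D (empirical_mean n s) (search Q \<theta> b\<^sub>0 (b # bs))}"
    by auto
  finally show ?case .
qed simp

text \<open>An invalid run contains a query whose empirical mean is invalid, so a union bound over
  the list applies. Because the family is fixed in advance, the same samples can serve all
  queries.\<close>

lemma simulates_vstat_search:
  assumes D: "prob_space D" and Q: "\<And>b. b \<in> set bs \<Longrightarrow> Q b \<in> borel_measurable D"
    and Q01: "\<And>b z. b \<in> set bs \<Longrightarrow> z \<in> space D \<Longrightarrow> Q b z \<in> {0..1}"
    and m: "m > 0" and n: "n > 0"
    and \<delta>: "2 * real (length bs) * exp (- real n / (4 * real m)) \<le> \<delta>"
  shows "simulates_vstat m D (search Q \<theta> b\<^sub>0 bs) n (empirical_mean n) \<delta>"
proof -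
  let ?S = "iid_samples n D"
  interpret S: prob_space ?S
    unfolding iid_samples_def by (intro prob_space_PiM D)
  let ?G = "{s \<in> space ?S. vstat_run m D (empirical_mean n s) (search Q \<theta> b\<^sub>0 bs)}"
  let ?B = "\<lambda>b. {s \<in> space ?S. empirical_mean n s (Q b) \<notin> vstat m D (Q b)}"
  have B: "?B b \<in> sets ?S" if "b \<in> set bs" for b
  proof -
    have "?B b = space ?S - {s \<in> space ?S. empirical_mean n s (Q b) \<in> vstat m D (Q b)}" by auto
    then show ?thesis using measurable_empirical_mean_vstat[OF Q[OF that], of n m] by simp
  qed
  have "1 - S.prob ?G = S.prob (space ?S - ?G)"
    by (intro S.prob_compl[symmetric] measurable_vstat_run_search Q)
  also have "\<dots> \<le> S.prob (\<Union>b\<in>set bs. ?B b)"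
  proof (rule S.finite_measure_mono)
    show "space ?S - ?G \<subseteq> (\<Union>b\<in>set bs. ?B b)"
      using vstat_run_search[of bs "empirical_mean n _" Q m D \<theta> b\<^sub>0] by blast
  qed (use B in auto)
  also have "\<dots> \<le> (\<Sum>b\<in>set bs. S.prob (?B b))"
    using B by (intro S.finite_measure_subadditive_finite) auto
  also have "\<dots> \<le> (\<Sum>b\<in>set bs. 2 * exp (- real n / (4 * real m)))"
    by (intro sum_mono prob_empirical_mean_not_vstat_le D Q Q01 m n)
  also have "\<dots> \<le> real (length bs) * (2 * exp (- real n / (4 * real m)))"
    by (simp add: card_length mult_right_mono)
  finally show ?thesis using \<delta> by (simp add: simulates_vstat_def)
qed

section \<open>Numerical choices: threshold, size of the net, number of samples\<close>

lemma vstat_answer_ge: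
  assumes u: "u \<in> vstat m D f" and p: "15 / 16 * \<alpha> \<le> (\<integral>z. f z \<partial>D)"
    and \<alpha>: "\<alpha> > 0" and m: "100 / \<alpha> \<le> real m"
  shows "\<alpha> / 2 \<le> u"
proof -
  define p where "p = (\<integral>z. f z \<partial>D)"
  have p0: "15 / 16 * \<alpha> \<le> p" "p > 0" using p \<alpha> by (simp_all add: p_def)
  have m0: "real m > 0" using m \<alpha> by (meson divide_pos_pos less_le_trans zero_less_numeral)
  have m1: "1 / real m \<le> \<alpha> / 100" using m m0 \<alpha> by (simp add: field_simps)
  have "p * (1 - p) / real m \<le> p / real m"
    using p0 m0 by (intro divide_right_mono) (auto simp: mult_left_le)
  also have "\<dots> \<le> p * (\<alpha> / 100)" using mult_left_mono[OF m1, of p] p0 by simp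
  \<comment> \<open>From \<open>\<alpha> \<le> 16 / 15 * p\<close> follows
    \<open>\<alpha> / 100 \<le> p / 81\<close>. The resulting tolerance \<open>p / 9\<close> leaves
    \<open>u\<close> at least \<open>8 / 9 * 15 / 16 * \<alpha> = 5 / 6 * \<alpha>\<close>, above
    the threshold.\<close>
  also have "\<dots> \<le> p * (p / 81)" using p0 by (intro mult_left_mono) auto
  also have "\<dots> = (p / 9)\<^sup>2" by (simp add: power2_eq_square)
  finally have "sqrt (p * (1 - p) / real m) \<le> p / 9" using p0 by (intro real_le_lsqrt) auto
  moreover have "1 / real m \<le> p / 9" using m1 p0 by linarith
  ultimately have "\<bar>u - p\<bar> \<le> p / 9" using u by (simp add: vstat_def Let_def p_def max_def split: if_splits)
  then show ?thesis using p0 by linarith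
qed

text \<open>Both branches of the tolerance are at most \<open>\<alpha> / 10\<close>, so an answer is
  at most \<open>\<alpha> / 5\<close>.\<close>

lemma vstat_answer_less:
  assumes u: "u \<in> vstat m D f" and p: "0 \<le> (\<integral>z. f z \<partial>D)" "(\<integral>z. f z \<partial>D) \<le> \<alpha> / 10"
    and \<alpha>: "\<alpha> > 0" and m: "100 / \<alpha> \<le> real m"
  shows "u < \<alpha> / 2"
proof -
  define p where "p = (\<integral>z. f z \<partial>D)"
  have p0: "0 \<le> p" "p \<le> \<alpha> / 10" using p by (simp_all add: p_def)
  have m0: "real m > 0" using m \<alpha> by (meson divide_pos_pos less_le_trans zero_less_numeral)
  have m1: "1 / real m \<le> \<alpha> / 100" using m m0 \<alpha> by (simp add: field_simps)
  have "p * (1 - p) / real m \<le> p / real m"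
    using p0 m0 by (intro divide_right_mono) (auto simp: mult_left_le)
  also have "\<dots> \<le> p * (\<alpha> / 100)" using mult_left_mono[OF m1, of p] p0 by simp
  also have "\<dots> \<le> \<alpha> / 10 * (\<alpha> / 10)" using p0 \<alpha> by (intro mult_mono) auto
  also have "\<dots> = (\<alpha> / 10)\<^sup>2" by (simp add: power2_eq_square)
  finally have "sqrt (p * (1 - p) / real m) \<le> \<alpha> / 10" using \<alpha> by (intro real_le_lsqrt) auto
  moreover have "1 / real m \<le> \<alpha> / 10" using m1 \<alpha> by linarith
  ultimately have "\<bar>u - p\<bar> \<le> \<alpha> / 10" using u by (simp add: vstat_def Let_def p_def max_def split: if_splits)
  then show ?thesis using p0 \<alpha> by linarith
qed

text \<open>The base of the counting bound is at most \<open>243 / x\<close>. Since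
  \<open>x \<le> 1 / 2\<close>, the constant 243 is below \<open>2 ^ 8\<close> and is absorbed into
  eight further powers of \<open>1 / x\<close>.\<close>

lemma card_grid_net_le_exp:
  fixes x :: real
  assumes x: "0 < x" "x \<le> 1 / 2"
  shows "real (card (grid_net d (x / 40))) \<le> exp (9 * (real d * ln (1 / x)))"
proof -
  have "2 \<le> 1 / x" using x by (simp add: field_simps)
  then have "(2 :: real) ^ 8 \<le> (1 / x) ^ 8" by (intro power_mono) auto
  then have "243 \<le> (1 / x) ^ 8" by simp
  then have pow: "243 * (1 / x) \<le> (1 / x) ^ 8 * (1 / x)" using x by (intro mult_right_mono) auto
  have "exp 1 * (1 + 2 / (x / 40)) \<le> 3 * (81 * (1 / x))"
    using x exp_le by (intro mult_mono) (auto simp: field_simps)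
  also have "\<dots> \<le> (1 / x) ^ 9" using pow by (simp add: eval_nat_numeral)
  also have "\<dots> = exp (9 * ln (1 / x))"
    using x exp_of_nat_mult[of 9 "ln (1 / x)"] by simp
  finally have "(exp 1 * (1 + 2 / (x / 40))) ^ d \<le> exp (9 * ln (1 / x)) ^ d"
    using x by (intro power_mono) auto
  also have "\<dots> = exp (9 * (real d * ln (1 / x)))"
    by (simp add: mult.left_commute flip: exp_of_nat_mult)
  finally show ?thesis using card_grid_net_le[of "x / 40" d] x by simp
qed

text \<open>The factor \<open>exp 1\<close> in the logarithm supplies the summand 1, which later
  absorbs \<open>ln 2\<close> and the rounding of the sample size.\<close>

lemma ln_sample_bound_ge:
  fixes \<alpha> \<tau> :: real
  assumes "1 \<le> d" "0 < \<alpha>" "0 < \<tau>"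
  shows "1 + ln (1 / (\<tau> * \<alpha>)) \<le> ln (exp 1 * real d / (\<alpha> * \<tau>))"
proof -
  have "ln (exp 1 * real d / (\<alpha> * \<tau>)) = 1 + ln (real d) + ln (1 / (\<tau> * \<alpha>))"
    using assms by (simp add: ln_div ln_mult)
  moreover have "ln (real d) \<ge> 0" using assms by simp
  ultimately show ?thesis by linarith
qed

lemma sample_size_exists:
  fixes \<alpha> \<delta> l L :: real
  assumes \<alpha>: "0 < \<alpha>" "\<alpha> < 1" and \<delta>: "0 < \<delta>" "\<delta> < 1" and d: "1 \<le> d" and m: "0 < m" "real m \<le> 101 / \<alpha>"
    and ll: "0 \<le> l" "1 + l \<le> L" and N: "real N \<le> exp (9 * (real d * l))"
  shows "\<exists>n>0. 2 * real N * exp (- real n / (4 * real m)) \<le> \<delta>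
    \<and> real n \<le> 5000 * ((real d * L + ln (1 / \<delta>)) / \<alpha>)"
proof -
  \<comment> \<open>The solution of \<open>2 * exp (9 * d * l) * exp (- K) = \<delta>\<close>, so
    that \<open>4 * m * K\<close> samples suffice for the union bound.\<close>
  define K where "K = ln 2 + 9 * (real d * l) + ln (1 / \<delta>)"
  define n where "n = nat \<lceil>4 * real m * K\<rceil>"
  have ln_\<delta>: "ln (1 / \<delta>) > 0" using \<delta> by simp
  have dl: "0 \<le> real d * l" using ll by simp
  have ln2: "(0::real) < ln 2" by simp
  have K0: "0 < K" unfolding K_def using ln_\<delta> dl ln2 by linarith
  then have mK: "0 < 4 * real m * K" using m by simp
  have n_ge: "4 * real m * K \<le> real n" unfolding n_def by linarith
  have n_le: "real n \<le> 4 * real m * K + 1" unfolding n_def using mK by linarith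
  have "K \<le> real n / (4 * real m)" using n_ge m by (simp add: field_simps)
  then have "exp (- real n / (4 * real m)) \<le> exp (- K)" by simp
  also have "exp (- K) = \<delta> / (2 * exp (9 * (real d * l)))"
    using \<delta> by (simp add: K_def exp_minus exp_add ln_div exp_diff field_simps)
  finally have "2 * real N * exp (- real n / (4 * real m))
      \<le> 2 * exp (9 * (real d * l)) * (\<delta> / (2 * exp (9 * (real d * l))))"
    using N by (intro mult_mono) auto
  then have 1: "2 * real N * exp (- real n / (4 * real m)) \<le> \<delta>" by simp
  have dL: "real d * (1 + l) \<le> real d * L" using ll by (intro mult_left_mono) auto
  have d1: "1 \<le> real d" using d by simp
  have "K \<le> 9 * (real d * L) + ln (1 / \<delta>)"
    unfolding K_def using ln_2_less_1 dL d1 by (simp add: algebra_simps)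
  then have "4 * real m * K \<le> 4 * (101 / \<alpha>) * (9 * (real d * L) + ln (1 / \<delta>))"
    using m K0 \<alpha> by (intro mult_mono) auto
  moreover have "1 \<le> real d * L / \<alpha>"
  proof -
    have "\<alpha> \<le> real d * L" using \<alpha> dL d1 dl by (simp add: algebra_simps)
    then show ?thesis using \<alpha> by simp
  qed
  ultimately have "real n \<le> 4 * (101 / \<alpha>) * (9 * (real d * L) + ln (1 / \<delta>)) + real d * L / \<alpha>"
    using n_le by linarith
  \<comment> \<open>Here \<open>404 = 4 * 101\<close> and \<open>3637 = 404 * 9 + 1\<close>, the
    last 1 paying for the ceiling.\<close>
  also have "\<dots> = (3637 * (real d * L) + 404 * ln (1 / \<delta>)) / \<alpha>"
    using \<alpha> by (simp add: field_simps)
  also have "\<dots> \<le> (5000 * (real d * L) + 5000 * ln (1 / \<delta>)) / \<alpha>"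
    using \<alpha> ln_\<delta> dL d1 dl by (intro divide_right_mono add_mono mult_right_mono) (auto simp: algebra_simps)
  also have "\<dots> = 5000 * ((real d * L + ln (1 / \<delta>)) / \<alpha>)" using \<alpha> by (simp add: field_simps)
  finally have 2: "real n \<le> 5000 * ((real d * L + ln (1 / \<delta>)) / \<alpha>)" .
  have "n > 0" using n_ge mK by (intro gr0I) simp
  with 1 2 show ?thesis by blast
qed

text \<open>The radius \<open>\<tau> * \<alpha> / 10\<close> is four times the mesh parameter
  \<open>\<tau> * \<alpha> / 40\<close>, so a net point near \<open>\<beta>\<close> passes under
  every valid answer. At distance more than \<open>\<tau>\<close> the same radius gives acceptance
  probability at most \<open>\<alpha> / 10\<close>, which no valid answer lifts to the
  threshold.\<close>

lemma search_outputs_accurate: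
  assumes \<alpha>: "0 < \<alpha>" and \<tau>: "0 < \<tau>" and d: "1 \<le> d"
    and bs: "set bs = grid_net d (\<tau> * \<alpha> / 40)" and m: "100 / \<alpha> \<le> real m"
    and \<beta>: "L2_set \<beta> {..<d} \<le> 1" and noise: "oblivious_noise \<alpha> E"
    and b: "b \<in> vstat_outputs m (regression_dist d \<beta> E)
      (search (residual_query d (\<tau> * \<alpha> / 10)) (\<alpha> / 2) b\<^sub>0 bs)"
  shows "L2_set (\<lambda>i. b i - \<beta> i) {..<d} \<le> \<tau>"
proof -
  let ?D = "regression_dist d \<beta> E" and ?r = "\<tau> * \<alpha> / 10" and ?\<epsilon> = "\<tau> * \<alpha> / 40"
  have E: "prob_space E" "sets E = sets borel" using noise by (auto simp: oblivious_noise_def)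
  have \<epsilon>: "?\<epsilon> > 0" using \<alpha> \<tau> by simp
  obtain c where c: "c \<in> set bs" "L2_set (\<lambda>i. \<beta> i - c i) {..<d} \<le> ?\<epsilon>"
    using grid_net_covers[OF \<epsilon> d \<beta>] bs by auto
  have "15 / 16 * \<alpha> \<le> (\<integral>z. residual_query d ?r c z \<partial>?D)"
    using integral_residual_query_ge[OF noise \<epsilon> _ c(2)] \<alpha> by (simp add: mult.commute)
  then have "\<forall>u\<in>vstat m ?D (residual_query d ?r c). \<alpha> / 2 \<le> u"
    using vstat_answer_ge \<alpha> m by blast
  with c(1) have "\<exists>c\<in>set bs. \<forall>u\<in>vstat m ?D (residual_query d ?r c). \<alpha> / 2 \<le> u" by blast
  from vstat_outputs_search[OF this b] obtain u
    where u: "u \<in> vstat m ?D (residual_query d ?r b)" "\<alpha> / 2 \<le> u" by blast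
  have "L2_set (\<lambda>i. \<beta> i - b i) {..<d} \<le> \<tau>"
  proof (rule ccontr)
    assume "\<not> ?thesis"
    then have far: "\<tau> < L2_set (\<lambda>i. \<beta> i - b i) {..<d}" by simp
    have "(\<integral>z. residual_query d ?r b z \<partial>?D) \<le> ?r / L2_set (\<lambda>i. \<beta> i - b i) {..<d}"
      using \<alpha> \<tau> far by (intro integral_residual_query_le E) auto
    also have "\<dots> \<le> ?r / \<tau>" using far \<alpha> \<tau> by (intro divide_left_mono) auto
    also have "\<dots> = \<alpha> / 10" using \<tau> by simp
    finally have le: "(\<integral>z. residual_query d ?r b z \<partial>?D) \<le> \<alpha> / 10" .
    have "0 \<le> (\<integral>z. residual_query d ?r b z \<partial>?D)"
      using residual_query_in_01 by (intro integral_nonneg_AE) auto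
    from vstat_answer_less[OF u(1) this le \<alpha> m] u(2) show False by simp
  qed
  moreover have "L2_set (\<lambda>i. b i - \<beta> i) {..<d} = L2_set (\<lambda>i. \<beta> i - b i) {..<d}"
    by (simp add: L2_set_def power2_commute)
  ultimately show ?thesis by simp
qed

text \<open>\<open>A\<close>, \<open>m\<close> and \<open>sim\<close> are fixed before
  \<open>\<beta>\<close> and \<open>E\<close>, so they cannot depend on the unknown distribution.
  The exponent \<open>k\<close> makes the polylogarithmic factor explicit, and \<open>exp 1\<close>
  keeps that logarithm at least 1.\<close>

theorem theoremD1:
  shows "\<exists>C>0. \<exists>k::nat. \<forall>d::nat. \<forall>\<alpha>::real. \<forall>\<tau>::real. 1 \<le> d \<longrightarrow> \<alpha> \<in> {0<..<1} \<longrightarrow> \<tau> \<in> {0<..<1} \<longrightarrow>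
    (\<exists>(A :: (point, nat \<Rightarrow> real) sq_alg) (q::nat) (m::nat).
       valid_queries (data_space d) A \<and>
       at_most_queries A q \<and> real q \<le> exp (C * (real d * ln (1 / (\<tau> * \<alpha>)))) \<and>
       0 < m \<and> real m \<le> C * (1 / \<alpha>) \<and>
       (\<forall>\<beta> E. L2_set \<beta> {..<d} \<le> 1 \<longrightarrow> oblivious_noise \<alpha> E \<longrightarrow>
          (\<forall>b \<in> vstat_outputs m (regression_dist d \<beta> E) A.
             L2_set (\<lambda>i. b i - \<beta> i) {..<d} \<le> C * \<tau>)) \<and>
       (\<forall>\<delta>\<in>{0<..<1}. \<exists>(m'::nat) sim.
          real m' \<le> C * ((real d * ln (exp 1 * real d / (\<alpha> * \<tau>)) ^ k + ln (1 / \<delta>)) / \<alpha>) \<and>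
          (\<forall>\<beta> E. L2_set \<beta> {..<d} \<le> 1 \<longrightarrow> oblivious_noise \<alpha> E \<longrightarrow>
             simulates_vstat m (regression_dist d \<beta> E) A m' sim \<delta>)))"
\<comment> \<open>The constant 5000 is dictated by the sample size; the other bounds need far less.
  A single logarithm suffices.\<close>
proof (intro exI[of _ "5000::real"] exI[of _ "1::nat"] conjI allI impI, simp)
  fix d :: nat and \<alpha> \<tau> :: real
  assume d: "1 \<le> d" and "\<alpha> \<in> {0<..<1}" and "\<tau> \<in> {0<..<1}"
  then have \<alpha>: "0 < \<alpha>" "\<alpha> < 1" and \<tau>: "0 < \<tau>" "\<tau> < 1" by auto
  let ?x = "\<tau> * \<alpha>"
  let ?l = "ln (1 / ?x)" and ?L = "ln (exp 1 * real d / (\<alpha> * \<tau>))"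
  have x: "0 < ?x" "?x < 1" using \<alpha> \<tau> mult_strict_mono[of \<tau> 1 \<alpha> 1] by auto
  have l: "0 \<le> ?l" using x by simp
  have L: "1 + ?l \<le> ?L" by (rule ln_sample_bound_ge[OF d \<alpha>(1) \<tau>(1)])
  show "\<exists>(A :: (point, nat \<Rightarrow> real) sq_alg) (q::nat) (m::nat).
       valid_queries (data_space d) A \<and>
       at_most_queries A q \<and> real q \<le> exp (5000 * (real d * ?l)) \<and>
       0 < m \<and> real m \<le> 5000 * (1 / \<alpha>) \<and>
       (\<forall>\<beta> E. L2_set \<beta> {..<d} \<le> 1 \<longrightarrow> oblivious_noise \<alpha> E \<longrightarrow>
          (\<forall>b \<in> vstat_outputs m (regression_dist d \<beta> E) A.
             L2_set (\<lambda>i. b i - \<beta> i) {..<d} \<le> 5000 * \<tau>)) \<and>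
       (\<forall>\<delta>\<in>{0<..<1}. \<exists>(m'::nat) sim.
          real m' \<le> 5000 * ((real d * ?L ^ 1 + ln (1 / \<delta>)) / \<alpha>) \<and>
          (\<forall>\<beta> E. L2_set \<beta> {..<d} \<le> 1 \<longrightarrow> oblivious_noise \<alpha> E \<longrightarrow>
             simulates_vstat m (regression_dist d \<beta> E) A m' sim \<delta>))"
  proof (cases "\<tau> < 1 / 2")
    case False
    \<comment> \<open>Here \<open>ln (1 / (\<tau> \<alpha>))\<close> may be close to 0, so that the budget allows no net;
      but 0 is accurate enough.\<close>
    let ?A = "Output (\<lambda>_. 0) :: (point, nat \<Rightarrow> real) sq_alg"
    have acc: "L2_set (\<lambda>i. b i - \<beta> i) {..<d} \<le> 5000 * \<tau>"
      if "L2_set \<beta> {..<d} \<le> 1" "b \<in> vstat_outputs 1 (regression_dist d \<beta> E) ?A" for \<beta> E b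
    proof -
      have "L2_set (\<lambda>i. b i - \<beta> i) {..<d} = L2_set \<beta> {..<d}" using that(2) by (simp add: L2_set_def)
      then show ?thesis using that(1) False by simp
    qed
    \<comment> \<open>No query is asked, so every run is valid and zero samples are enough.\<close>
    have sim: "simulates_vstat 1 (regression_dist d \<beta> E) ?A 0 (\<lambda>_ _. 0) \<delta>"
      if "oblivious_noise \<alpha> E" "\<delta> \<in> {0<..<1}" for \<beta> E \<delta>
    proof -
      have "prob_space (iid_samples 0 (regression_dist d \<beta> E))"
        using that(1) unfolding iid_samples_def oblivious_noise_def
        by (intro prob_space_PiM prob_space_regression_dist) auto
      then show ?thesis
        using that(2) by (simp add: simulates_vstat_def prob_space.prob_space)
    qed
    have size: "real 0 \<le> 5000 * ((real d * ?L ^ 1 + ln (1 / \<delta>)) / \<alpha>)" if "\<delta> \<in> {0<..<1}" for \<delta>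
    proof -
      have "0 \<le> ?L" using l L by linarith
      then show ?thesis using that \<alpha> by simp
    qed
    show ?thesis
    proof (rule exI[of _ ?A], rule exI[of _ 0], rule exI[of _ 1], intro conjI allI impI ballI)
      show "real 1 \<le> 5000 * (1 / \<alpha>)" using \<alpha> by (simp add: field_simps)
      show "\<exists>(m'::nat) sim. real m' \<le> 5000 * ((real d * ?L ^ 1 + ln (1 / \<delta>)) / \<alpha>) \<and>
          (\<forall>\<beta> E. L2_set \<beta> {..<d} \<le> 1 \<longrightarrow> oblivious_noise \<alpha> E \<longrightarrow>
             simulates_vstat 1 (regression_dist d \<beta> E) ?A m' sim \<delta>)" if "\<delta> \<in> {0<..<1}" for \<delta>
        using size[OF that] sim[OF _ that] by blast
      show "L2_set (\<lambda>i. b i - \<beta> i) {..<d} \<le> 5000 * \<tau>"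
        if "L2_set \<beta> {..<d} \<le> 1" "b \<in> vstat_outputs 1 (regression_dist d \<beta> E) ?A" for \<beta> E b
        using that by (rule acc)
    qed auto
  next
    case True
    obtain bs where bs: "set bs = grid_net d (?x / 40)" "length bs = card (grid_net d (?x / 40))"
      using finite_distinct_list[OF finite_grid_net] distinct_card by metis
    \<comment> \<open>Rounding up costs at most \<open>1 \<le> 1 / \<alpha>\<close>, hence the bound
      \<open>101 / \<alpha>\<close> below.\<close>
    define m where "m = nat \<lceil>100 / \<alpha>\<rceil>"
    have m: "100 / \<alpha> \<le> real m" unfolding m_def by linarith
    have "0 < 100 / \<alpha>" using \<alpha> by simp
    then have m0: "0 < m" using m by (intro gr0I) auto
    have "real m \<le> 100 / \<alpha> + 1" unfolding m_def using \<open>0 < 100 / \<alpha>\<close> by linarith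
    also have "\<dots> \<le> 101 / \<alpha>" using \<alpha> by (simp add: field_simps)
    finally have m_le: "real m \<le> 101 / \<alpha>" .
    \<comment> \<open>This is where the case distinction enters: the size bound for the net needs
      \<open>1 / ?x\<close> bounded away from 1.\<close>
    have "?x \<le> 1 / 2 * 1" using True \<alpha> \<tau> by (intro mult_mono) auto
    then have N: "real (length bs) \<le> exp (9 * (real d * ?l))"
      unfolding bs(2) using x by (intro card_grid_net_le_exp) auto
    let ?Q = "residual_query d (?x / 10)"
    let ?A = "search ?Q (\<alpha> / 2) (\<lambda>_. 0) bs"
    show ?thesis
    proof (rule exI[of _ ?A], rule exI[of _ "length bs"], rule exI[of _ m], intro conjI allI impI ballI)
      show "valid_queries (data_space d) ?A"
        by (intro valid_queries_search measurable_residual_query residual_query_in_01)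
      show "at_most_queries ?A (length bs)" by (rule at_most_queries_search)
      have "9 * (real d * ?l) \<le> 5000 * (real d * ?l)" using l by (intro mult_right_mono) auto
      then show "real (length bs) \<le> exp (5000 * (real d * ?l))"
        using N by (meson exp_le_cancel_iff order_trans)
      show "0 < m" by (rule m0)
      have "101 / \<alpha> \<le> 5000 * (1 / \<alpha>)" using \<alpha> by (simp add: field_simps)
      then show "real m \<le> 5000 * (1 / \<alpha>)" using m_le by linarith
    next
      fix \<beta> E and b :: "nat \<Rightarrow> real"
      assume "L2_set \<beta> {..<d} \<le> 1" "oblivious_noise \<alpha> E" "b \<in> vstat_outputs m (regression_dist d \<beta> E) ?A"
      from search_outputs_accurate[OF \<alpha>(1) \<tau>(1) d bs(1) m this] \<tau>
      show "L2_set (\<lambda>i. b i - \<beta> i) {..<d} \<le> 5000 * \<tau>" by linarith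
    next
      fix \<delta> :: real assume "\<delta> \<in> {0<..<1}"
      then have \<delta>: "0 < \<delta>" "\<delta> < 1" by auto
      from sample_size_exists[OF \<alpha> \<delta> d m0 m_le l L N] obtain n where n: "n > 0"
        "2 * real (length bs) * exp (- real n / (4 * real m)) \<le> \<delta>"
        "real n \<le> 5000 * ((real d * ?L + ln (1 / \<delta>)) / \<alpha>)" by blast
      have "simulates_vstat m (regression_dist d \<beta> E) ?A n (empirical_mean n) \<delta>"
        if "oblivious_noise \<alpha> E" for \<beta> E
      proof (rule simulates_vstat_search[OF _ _ _ m0 n(1,2)])
        show "prob_space (regression_dist d \<beta> E)"
          using that by (intro prob_space_regression_dist) (auto simp: oblivious_noise_def)
        show "?Q b \<in> borel_measurable (regression_dist d \<beta> E)" for b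
          by (subst measurable_cong_sets[OF sets_regression_dist refl]) (rule measurable_residual_query)
      qed (rule residual_query_in_01)
      with n(3) show "\<exists>(m'::nat) sim.
          real m' \<le> 5000 * ((real d * ?L ^ 1 + ln (1 / \<delta>)) / \<alpha>) \<and>
          (\<forall>\<beta> E. L2_set \<beta> {..<d} \<le> 1 \<longrightarrow> oblivious_noise \<alpha> E \<longrightarrow>
             simulates_vstat m (regression_dist d \<beta> E) ?A m' sim \<delta>)"
        by (intro exI[of _ n] exI[of _ "empirical_mean n"]) auto
    qed
  qed
qed

end
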